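(* Let $q\in\mathbb{C}$ with $|q|<1$, let $k\ge 1$ be an integer, and let $a,c,\alpha_j,\beta_j,x_j,y_j$ ($1\le j\le k$) be complex numbers. If $\max\{|a|,|c|,|x_1|,|y_1|,\ldots,|x_k|,|y_k|\}<1$, then $$\sum_{n_1,\ldots,n_k=0}^\infty\frac{(a;q)_{n_1+\cdots+n_k}\,\Phi^{(\alpha_1,\beta_1)}_{n_1}(x_1,y_1|q)\cdots\Phi^{(\alpha_k,\beta_k)}_{n_k}(x_k,y_k|q)}{(c;q)_{n_1+\cdots+n_k}(q;q)_{n_1}\cdots(q;q)_{n_k}}$$ $$=\frac{(a,\alpha_1x_1,\beta_1y_1,\ldots,\alpha_kx_k,\beta_ky_k;q)_\infty}{(c,x_1,y_1,\ldots,x_k,y_k;q)_\infty}\;{}_{2k+1}\phi_{2k}\left({c/a,\,x_1,\,y_1,\ldots,x_k,\,y_k\atop \alpha_1x_1,\,\beta_1y_1,\ldots,\alpha_kx_k,\,\beta_ky_k};q,a\right).$$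
   Context: For $a\in\mathbb{C}$: $(a;q)_0=1$, $(a;q)_n=\prod_{i=0}^{n-1}(1-aq^i)$, $(a;q)_\infty=\prod_{i=0}^\infty(1-aq^i)$, and $(a_1,\ldots,a_m;q)_n=(a_1;q)_n\cdots(a_m;q)_n$ for $n$ a nonnegative integer or $\infty$. The $q$-binomial coefficient is ${n\brack k}_q=\frac{(q;q)_n}{(q;q)_k(q;q)_{n-k}}$, and $\Phi_n^{(\alpha,\beta)}(x,y|q)=\sum_{k=0}^n {n\brack k}_q(\alpha;q)_k(\beta;q)_{n-k}x^ky^{n-k}$. The basic hypergeometric series is $${}_r\phi_s\left({a_1,\ldots,a_r\atop b_1,\ldots,b_s};q,z\right)=\sum_{n=0}^\infty\frac{(a_1,\ldots,a_r;q)_n}{(q,b_1,\ldots,b_s;q)_n}\left((-1)^nq^{n(n-1)/2}\right)^{1+s-r}z^n,$$ so for $r=s+1$ the power of $(-1)^nq^{n(n-1)/2}$ is absent. *)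

theory Defs
  imports "HOL-Analysis.Analysis"
begin

definition qpoch :: "complex \<Rightarrow> complex \<Rightarrow> nat \<Rightarrow> complex" where
  "qpoch a q n = (\<Prod>i<n. 1 - a * q ^ i)"

definition qpoch_inf :: "complex \<Rightarrow> complex \<Rightarrow> complex" where
  "qpoch_inf a q = (\<Prod>i. 1 - a * q ^ i)"

definition qpochs :: "complex list \<Rightarrow> complex \<Rightarrow> nat \<Rightarrow> complex" where
  "qpochs as q n = (\<Prod>a\<leftarrow>as. qpoch a q n)"

definition qpochs_inf :: "complex list \<Rightarrow> complex \<Rightarrow> complex" where
  "qpochs_inf as q = (\<Prod>a\<leftarrow>as. qpoch_inf a q)"

definition qbinom :: "complex \<Rightarrow> nat \<Rightarrow> nat \<Rightarrow> complex" where
  "qbinom q n k = qpoch q q n / (qpoch q q k * qpoch q q (n - k))"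

definition qPhi :: "nat \<Rightarrow> complex \<Rightarrow> complex \<Rightarrow> complex \<Rightarrow> complex \<Rightarrow> complex \<Rightarrow> complex" where
  "qPhi n \<alpha> \<beta> x y q =
     (\<Sum>k\<le>n. qbinom q n k * qpoch \<alpha> q k * qpoch \<beta> q (n - k) * x ^ k * y ^ (n - k))"

(* The exponent 1 + s - r may be negative, hence an integer power. *)
definition basic_hypergeometric :: "complex list \<Rightarrow> complex list \<Rightarrow> complex \<Rightarrow> complex \<Rightarrow> complex" where
  "basic_hypergeometric as bs q z =
     (\<Sum>n. qpochs as q n / qpochs (q # bs) q n
            * ((-1) ^ n * q ^ (n * (n - 1) div 2)) powi (1 + int (length bs) - int (length as))
            * z ^ n)"

(* The list [u 1, v 1, ..., u k, v k]. *)
definition interleave :: "nat \<Rightarrow> (nat \<Rightarrow> 'a) \<Rightarrow> (nat \<Rightarrow> 'a) \<Rightarrow> 'a list" where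
  "interleave k u v = concat (map (\<lambda>j. [u j, v j]) [1..<Suc k])"

end

theory Submission
  imports Defs
begin

text \<open>
  The quotient \<open>(a;q)\<^sub>N / (c;q)\<^sub>N\<close> is the only factor of the summand that couples the indices
  \<open>n\<^sub>1, \<dots>, n\<^sub>k\<close>, through their sum \<open>N\<close>.  The idea is to write it as a superposition of the
  geometric weights \<open>(q\<^sup>m)\<^sup>N\<close>, which factor over the indices.  Since
  \<open>(a;q)\<^sub>N = (a;q)\<^sub>\<infinity> / (a q\<^sup>N;q)\<^sub>\<infinity>\<close>, the quotient is a constant times
  \<open>(c q\<^sup>N;q)\<^sub>\<infinity> / (a q\<^sup>N;q)\<^sub>\<infinity>\<close>, and the \<open>q\<close>-binomial theorem (\<open>qbinomial_theorem\<close>) at the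
  argument \<open>a q\<^sup>N\<close> with parameter \<open>c / a\<close> expands this as
  \<open>\<Sum>m. (c/a;q)\<^sub>m / (q;q)\<^sub>m a\<^sup>m (q\<^sup>m)\<^sup>N\<close> (\<open>qpoch_ratio_series\<close>).

  After the sums are interchanged, the sum over \<open>n\<^sub>1, \<dots>, n\<^sub>k\<close> for fixed \<open>m\<close> splits into \<open>k\<close>
  generating functions of the polynomials \<open>\<Phi>\<^sub>n\<close>, evaluated at \<open>t = q\<^sup>m\<close>.  The sequence
  \<open>\<Phi>\<^sub>n / (q;q)\<^sub>n\<close> is the convolution of the coefficient sequences of two \<open>q\<close>-binomial series, so its
  generating function is the product of two \<open>q\<close>-binomial series (\<open>qPhi_generating_function\<close>):
  \<open>(\<alpha> x t, \<beta> y t;q)\<^sub>\<infinity> / (x t, y t;q)\<^sub>\<infinity>\<close>.  At \<open>t = q\<^sup>m\<close> this is its value at \<open>t = 1\<close> times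
  \<open>(x, y;q)\<^sub>m / (\<alpha> x, \<beta> y;q)\<^sub>m\<close>.  The remaining sum over \<open>m\<close> is the basic hypergeometric series.

  Interchanging the sums is justified by absolute convergence: because \<open>\<bar>q\<^sup>m\<bar> \<le> 1\<close>, the terms are
  bounded by those at \<open>t = 1\<close>, which form a product of \<open>k + 1\<close> absolutely convergent series.
\<close>

section \<open>Shifted factorials\<close>

lemma qpoch_0 [simp]: "qpoch a q 0 = 1"
  by (simp add: qpoch_def)

lemma qpoch_Suc: "qpoch a q (Suc n) = qpoch a q n * (1 - a * q ^ n)"
  by (simp add: qpoch_def)

lemma qpoch_add: "qpoch a q (m + n) = qpoch a q m * qpoch (a * q ^ m) q n"
  by (induction n) (simp_all add: qpoch_Suc power_add mult.assoc)

lemma norm_mult_power_less_one: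
  fixes a q :: complex
  assumes "cmod q < 1" "cmod a < 1"
  shows "cmod (a * q ^ n) < 1"
proof -
  have "cmod (a * q ^ n) \<le> cmod a * 1"
    unfolding norm_mult norm_power using assms by (intro mult_left_mono power_le_one) auto
  then show ?thesis using assms by simp
qed

lemma one_minus_mult_power_nonzero:
  fixes a q :: complex
  assumes "cmod q < 1" "cmod a < 1"
  shows "1 - a * q ^ n \<noteq> 0"
  using norm_mult_power_less_one[OF assms, of n] by auto

lemma qpoch_nonzero:
  assumes "cmod q < 1" "cmod a < 1"
  shows "qpoch a q n \<noteq> 0"
  using one_minus_mult_power_nonzero[OF assms] by (simp add: qpoch_def)

lemma convergent_prod_qpoch:
  fixes a q :: complex
  assumes "cmod q < 1"
  shows "convergent_prod (\<lambda>i. 1 - a * q ^ i)"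
proof -
  have "summable (\<lambda>i. norm ((1 - a * q ^ i) - 1))"
    using assms by (simp add: norm_mult norm_power summable_mult summable_geometric)
  then show ?thesis
    by (intro abs_convergent_prod_imp_convergent_prod summable_imp_abs_convergent_prod)
qed

lemma qpoch_tendsto_qpoch_inf:
  assumes "cmod q < 1"
  shows "(\<lambda>n. qpoch a q n) \<longlonglongrightarrow> qpoch_inf a q"
proof -
  have "(\<lambda>n. qpoch a q (Suc n)) \<longlonglongrightarrow> qpoch_inf a q"
    using convergent_prod_LIMSEQ[OF convergent_prod_qpoch[OF assms]]
    by (simp add: qpoch_def qpoch_inf_def lessThan_Suc_atMost)
  then show ?thesis by (simp only: filterlim_sequentially_Suc)
qed

lemma qpoch_inf_nonzero:
  assumes "cmod q < 1" "\<And>i. 1 - a * q ^ i \<noteq> 0"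
  shows "qpoch_inf a q \<noteq> 0"
  using prodinf_nonzero[OF convergent_prod_qpoch[OF assms(1)]] assms(2)
  by (simp add: qpoch_inf_def)

lemma qpoch_inf_split:
  assumes "cmod q < 1"
  shows "qpoch_inf a q = qpoch a q m * qpoch_inf (a * q ^ m) q"
proof (rule LIMSEQ_unique)
  show "(\<lambda>n. qpoch a q (n + m)) \<longlonglongrightarrow> qpoch_inf a q"
    by (rule LIMSEQ_ignore_initial_segment[OF qpoch_tendsto_qpoch_inf[OF assms]])
  show "(\<lambda>n. qpoch a q (n + m)) \<longlonglongrightarrow> qpoch a q m * qpoch_inf (a * q ^ m) q"
    by (subst add.commute, unfold qpoch_add)
       (intro tendsto_mult tendsto_const qpoch_tendsto_qpoch_inf assms)
qed

section \<open>The q-binomial theorem\<close>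

text \<open>
  The ratio of consecutive terms is \<open>(1 - A q\<^sup>n) / (1 - q\<^sup>n\<^sup>+\<^sup>1) z\<close>, which tends to \<open>z\<close>.
\<close>
lemma qbinomial_series_abs_summable:
  fixes A q z :: complex
  assumes q: "cmod q < 1" and z: "cmod z < 1"
  shows "summable (\<lambda>n. norm (qpoch A q n / qpoch q q n * z ^ n))"
proof -
  define r where "r = (\<lambda>n. (1 - A * q ^ n) / (1 - q * q ^ n) * z)"
  have "(\<lambda>n. q ^ n) \<longlonglongrightarrow> 0"
    using q by (rule LIMSEQ_power_zero)
  then have "(\<lambda>n. norm (r n)) \<longlonglongrightarrow> norm ((1 - A * 0) / (1 - q * 0) * z)"
    unfolding r_def using q by (intro tendsto_intros) auto
  then have lim: "(\<lambda>n. norm (r n)) \<longlonglongrightarrow> norm z" by simp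
  obtain d where d: "norm z < d" "d < 1"
    using z dense by blast
  obtain N where N: "\<And>n. n \<ge> N \<Longrightarrow> norm (r n) < d"
    using order_tendstoD(2)[OF lim d(1)] by (auto simp: eventually_sequentially)
  show ?thesis
  proof (rule summable_ratio_test[OF d(2)])
    fix n assume "n \<ge> N"
    have "qpoch A q (Suc n) / qpoch q q (Suc n) * z ^ Suc n
            = r n * (qpoch A q n / qpoch q q n * z ^ n)"
      by (simp add: qpoch_Suc r_def mult_ac)
    then show "norm (norm (qpoch A q (Suc n) / qpoch q q (Suc n) * z ^ Suc n))
            \<le> d * norm (norm (qpoch A q n / qpoch q q n * z ^ n))"
      using N[OF \<open>n \<ge> N\<close>]
      by (simp only: real_norm_def abs_norm_cancel norm_mult[of "r n"] abs_mult)
         (intro mult_right_mono, auto)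
  qed
qed

text \<open>
  The coefficients \<open>f n = (A;q)\<^sub>n / (q;q)\<^sub>n\<close> satisfy
  \<open>f (n + 1) (1 - q\<^sup>n\<^sup>+\<^sup>1) = f n (1 - A q\<^sup>n)\<close>.  Multiplied by \<open>z\<^sup>n\<^sup>+\<^sup>1\<close> and summed, the two sides
  become \<open>F z - F (q z)\<close> and \<open>z F z - A z F (q z)\<close>.
\<close>
lemma qbinomial_series_functional_equation:
  fixes A q z :: complex
  assumes q: "cmod q < 1" and z: "cmod z < 1"
  defines "F \<equiv> \<lambda>w. \<Sum>n. qpoch A q n / qpoch q q n * w ^ n"
  shows "(1 - z) * F z = (1 - A * z) * F (z * q)"
proof -
  define f where "f = (\<lambda>n. qpoch A q n / qpoch q q n)"
  have zq: "cmod (z * q) < 1"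
    using norm_mult_power_less_one[OF q z, of 1] by simp
  have Fsums: "(\<lambda>n. f n * w ^ n) sums F w" if "cmod w < 1" for w
    unfolding F_def f_def
    by (rule summable_sums[OF summable_norm_cancel[OF qbinomial_series_abs_summable[OF q that]]])
  note s = Fsums[OF z] Fsums[OF zq]
  have rec: "f (Suc n) * (1 - q ^ Suc n) = f n * (1 - A * q ^ n)" for n
    using one_minus_mult_power_nonzero[OF q q, of n] qpoch_nonzero[OF q q, of n]
    by (simp add: f_def qpoch_Suc)
  have eq1: "f n * (1 - q ^ n) * z ^ n = f n * z ^ n - f n * (z * q) ^ n" for n
    by (simp add: power_mult_distrib ring_distribs mult_ac)
  have "(\<lambda>n. f n * (1 - q ^ n) * z ^ n) sums (F z - F (z * q))"
    unfolding eq1 by (rule sums_diff[OF s])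
  then have shifted: "(\<lambda>n. f (Suc n) * (1 - q ^ Suc n) * z ^ Suc n) sums (F z - F (z * q))"
    using sums_Suc_iff[of "\<lambda>n. f n * (1 - q ^ n) * z ^ n"] by simp
  have eq2: "f (Suc n) * (1 - q ^ Suc n) * z ^ Suc n = z * (f n * z ^ n) - A * z * (f n * (z * q) ^ n)" for n
    unfolding rec by (simp add: power_mult_distrib ring_distribs mult_ac)
  have "(\<lambda>n. f (Suc n) * (1 - q ^ Suc n) * z ^ Suc n) sums (z * F z - A * z * F (z * q))"
    unfolding eq2 by (intro sums_diff sums_mult s)
  with shifted have "F z - F (z * q) = z * F z - A * z * F (z * q)"
    by (rule sums_unique2)
  then show ?thesis by (simp add: algebra_simps)
qed

text \<open>
  Iterating the functional equation \<open>n\<close> times moves the argument from \<open>z\<close> to \<open>z q\<^sup>n\<close>, where the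
  series tends to its value \<open>1\<close> at the origin; the accumulated factors tend to the infinite
  products.
\<close>
theorem qbinomial_theorem:
  fixes A q z :: complex
  assumes q: "cmod q < 1" and z: "cmod z < 1"
  shows "(\<lambda>n. qpoch A q n / qpoch q q n * z ^ n) sums (qpoch_inf (A * z) q / qpoch_inf z q)"
proof -
  define F where "F = (\<lambda>w. \<Sum>n. qpoch A q n / qpoch q q n * w ^ n)"
  have zq: "cmod (z * q ^ n) < 1" for n
    by (rule norm_mult_power_less_one[OF q z])
  have iter: "qpoch z q n * F z = qpoch (A * z) q n * F (z * q ^ n)" for n
  proof (induction n)
    case (Suc n)
    have "(1 - z * q ^ n) * F (z * q ^ n) = (1 - A * (z * q ^ n)) * F (z * q ^ n * q)"
      unfolding F_def by (rule qbinomial_series_functional_equation[OF q zq])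
    then have "qpoch (A * z) q n * ((1 - z * q ^ n) * F (z * q ^ n))
        = qpoch (A * z) q (Suc n) * F (z * q ^ Suc n)"
      by (simp add: qpoch_Suc mult_ac)
    with Suc.IH show ?case by (simp add: qpoch_Suc algebra_simps)
  qed simp
  have "isCont F 0"
    unfolding F_def
  proof (rule isCont_powser)
    show "summable (\<lambda>n. qpoch A q n / qpoch q q n * (1 / 2) ^ n)"
      by (rule summable_norm_cancel, rule qbinomial_series_abs_summable[OF q]) simp
  qed simp
  moreover have "(\<lambda>n. z * q ^ n) \<longlonglongrightarrow> 0"
    using tendsto_mult_right_zero[OF LIMSEQ_power_zero[OF q]] by simp
  ultimately have "(\<lambda>n. F (z * q ^ n)) \<longlonglongrightarrow> F 0"
    by (rule isCont_tendsto_compose)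
  moreover have "F 0 = 1"
    unfolding F_def powser_zero by simp
  ultimately have "(\<lambda>n. F (z * q ^ n)) \<longlonglongrightarrow> 1" by simp
  then have "(\<lambda>n. qpoch z q n * F z) \<longlonglongrightarrow> qpoch_inf (A * z) q * 1"
    unfolding iter by (intro tendsto_mult qpoch_tendsto_qpoch_inf q)
  moreover have "(\<lambda>n. qpoch z q n * F z) \<longlonglongrightarrow> qpoch_inf z q * F z"
    by (intro tendsto_mult tendsto_const qpoch_tendsto_qpoch_inf q)
  ultimately have "qpoch_inf z q * F z = qpoch_inf (A * z) q"
    using LIMSEQ_unique by fastforce
  moreover have "qpoch_inf z q \<noteq> 0"
    by (intro qpoch_inf_nonzero one_minus_mult_power_nonzero q z)
  ultimately have "F z = qpoch_inf (A * z) q / qpoch_inf z q"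
    by (simp add: field_simps)
  then show ?thesis
    unfolding F_def
    using summable_sums[OF summable_norm_cancel[OF qbinomial_series_abs_summable[OF q z, of A]]] by simp
qed

section \<open>The generating function of the polynomials\<close>

lemma qPhi_over_qpoch_conv_convolution:
  assumes q: "cmod q < 1"
  shows "qPhi n \<alpha> \<beta> x y q / qpoch q q n * t ^ n =
    (\<Sum>i\<le>n. (qpoch \<alpha> q i / qpoch q q i * (x * t) ^ i)
          * (qpoch \<beta> q (n - i) / qpoch q q (n - i) * (y * t) ^ (n - i)))"
proof -
  have "qbinom q n i * qpoch \<alpha> q i * qpoch \<beta> q (n - i) * x ^ i * y ^ (n - i) / qpoch q q n * t ^ n =
      (qpoch \<alpha> q i / qpoch q q i * (x * t) ^ i)
          * (qpoch \<beta> q (n - i) / qpoch q q (n - i) * (y * t) ^ (n - i))" if "i \<le> n" for i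
  proof -
    have t: "t ^ n = t ^ i * t ^ (n - i)"
      using that by (simp flip: power_add)
    show ?thesis
      unfolding t by (simp add: qbinom_def power_mult_distrib qpoch_nonzero[OF q q])
  qed
  then show ?thesis
    unfolding qPhi_def sum_divide_distrib sum_distrib_right by (intro sum.cong) auto
qed

text \<open>
  The Cauchy product of the \<open>q\<close>-binomial series at \<open>x t\<close> and at \<open>y t\<close>.
\<close>
lemma
  assumes q: "cmod q < 1" and x: "cmod (x * t) < 1" and y: "cmod (y * t) < 1"
  shows qPhi_generating_function:
      "(\<lambda>n. qPhi n \<alpha> \<beta> x y q / qpoch q q n * t ^ n) sums
        (qpoch_inf (\<alpha> * x * t) q * qpoch_inf (\<beta> * y * t) q /
          (qpoch_inf (x * t) q * qpoch_inf (y * t) q))" (is ?G)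
    and qPhi_generating_function_abs_summable:
      "summable (\<lambda>n. norm (qPhi n \<alpha> \<beta> x y q / qpoch q q n * t ^ n))" (is ?S)
proof -
  define f where "f = (\<lambda>i. qpoch \<alpha> q i / qpoch q q i * (x * t) ^ i)"
  define g where "g = (\<lambda>i. qpoch \<beta> q i / qpoch q q i * (y * t) ^ i)"
  have f: "summable (\<lambda>i. norm (f i))" and g: "summable (\<lambda>i. norm (g i))"
    unfolding f_def g_def by (intro qbinomial_series_abs_summable q x y)+
  have conv: "qPhi n \<alpha> \<beta> x y q / qpoch q q n * t ^ n = (\<Sum>i\<le>n. f i * g (n - i))" for n
    unfolding f_def g_def by (rule qPhi_over_qpoch_conv_convolution[OF q])
  have "suminf f = qpoch_inf (\<alpha> * x * t) q / qpoch_inf (x * t) q"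
    unfolding f_def using qbinomial_theorem[OF q x] by (simp add: sums_iff mult.assoc)
  moreover have "suminf g = qpoch_inf (\<beta> * y * t) q / qpoch_inf (y * t) q"
    unfolding g_def using qbinomial_theorem[OF q y] by (simp add: sums_iff mult.assoc)
  ultimately show ?G
    unfolding conv using Cauchy_product_sums[OF f g] by simp
  have "summable (\<lambda>n. \<Sum>i\<le>n. norm (f i) * norm (g (n - i)))"
    by (rule summable_Cauchy_product) (use f g in auto)
  then show ?S
    unfolding conv by (rule summable_comparison_test[rotated]) 
       (auto intro!: exI[of _ 0] order_trans[OF norm_sum] simp: norm_mult)
qed

section \<open>Separating the summation indices\<close>

text \<open>
  On the left, \<open>N\<close> occurs only in the power \<open>(q\<^sup>m)\<^sup>N\<close>, so that for \<open>N = n\<^sub>1 + \<dots> + n\<^sub>k\<close> each term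
  is a product of functions of the single \<open>n\<^sub>j\<close>.  The parameter \<open>c / a\<close> is the one for which the
  \<open>q\<close>-binomial theorem at \<open>a q\<^sup>N\<close> has numerator \<open>(c q\<^sup>N;q)\<^sub>\<infinity>\<close>.
\<close>
lemma qpoch_ratio_series:
  fixes a c q :: complex
  assumes q: "cmod q < 1" and a: "cmod a < 1" "a \<noteq> 0" and c: "cmod c < 1"
  shows "(\<lambda>m. qpoch_inf a q / qpoch_inf c q * (qpoch (c / a) q m / qpoch q q m * a ^ m * (q ^ m) ^ N))
    sums (qpoch a q N / qpoch c q N)"
proof -
  note z = norm_mult_power_less_one[OF q]
  have nz: "qpoch_inf (z * q ^ N) q \<noteq> 0" if "cmod z < 1" for z
    using z[OF that] by (intro qpoch_inf_nonzero one_minus_mult_power_nonzero q)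
  have "(\<lambda>m. qpoch (c / a) q m / qpoch q q m * (a * q ^ N) ^ m) sums
      (qpoch_inf (c / a * (a * q ^ N)) q / qpoch_inf (a * q ^ N) q)"
    by (rule qbinomial_theorem[OF q z[OF a(1)]])
  moreover have "c / a * (a * q ^ N) = c * q ^ N"
    using a by simp
  moreover have "(a * q ^ N) ^ m = a ^ m * (q ^ m) ^ N" for m
    unfolding power_mult_distrib by (simp only: power_mult[symmetric] mult.commute)
  ultimately have "(\<lambda>m. qpoch (c / a) q m / qpoch q q m * a ^ m * (q ^ m) ^ N) sums
      (qpoch_inf (c * q ^ N) q / qpoch_inf (a * q ^ N) q)"
    by (simp only: mult.assoc)
  then have "(\<lambda>m. qpoch_inf a q / qpoch_inf c q * (qpoch (c / a) q m / qpoch q q m * a ^ m * (q ^ m) ^ N))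
    sums (qpoch_inf a q / qpoch_inf c q * (qpoch_inf (c * q ^ N) q / qpoch_inf (a * q ^ N) q))"
    by (rule sums_mult)
  also have "qpoch_inf a q / qpoch_inf c q * (qpoch_inf (c * q ^ N) q / qpoch_inf (a * q ^ N) q)
      = qpoch a q N / qpoch c q N"
    using nz[OF a(1)] nz[OF c] qpoch_inf_split[OF q, of a N] qpoch_inf_split[OF q, of c N] by simp
  finally show ?thesis .
qed

section \<open>Interleaved parameter lists\<close>

lemma prod_list_map_interleave:
  fixes f :: "'a \<Rightarrow> 'b :: comm_monoid_mult"
  shows "(\<Prod>z\<leftarrow>interleave k u v. f z) = (\<Prod>j\<in>{1..k}. f (u j) * f (v j))"
  unfolding interleave_def by (induction k) (simp_all add: mult_ac)

lemma length_interleave: "length (interleave k u v) = 2 * k"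
  unfolding interleave_def by (induction k) simp_all

section \<open>Absolutely convergent multiple series\<close>

lemma prod_PiE_abs_summable_on:
  fixes w :: "'i \<Rightarrow> nat \<Rightarrow> complex"
  assumes "finite I" "\<And>i. i \<in> I \<Longrightarrow> summable (\<lambda>n. norm (w i n))"
  shows "(\<lambda>n. norm (\<Prod>i\<in>I. w i (n i))) summable_on (I \<rightarrow>\<^sub>E UNIV)"
proof -
  have "Infinite_Set_Sum.abs_summable_on (w i) UNIV" if "i \<in> I" for i
    using assms(2)[OF that] by (simp add: abs_summable_on_nat_iff')
  then have "Infinite_Set_Sum.abs_summable_on (\<lambda>n. \<Prod>i\<in>I. w i (n i)) (I \<rightarrow>\<^sub>E UNIV)"
    using assms(1) by (intro abs_summable_on_prod_PiE) auto
  then show ?thesis by (rule abs_summable_equivalent[THEN iffD2])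
qed

lemma prod_PiE_has_sum:
  fixes w :: "'i \<Rightarrow> nat \<Rightarrow> complex"
  assumes "finite I" and w: "\<And>i. i \<in> I \<Longrightarrow> summable (\<lambda>n. norm (w i n))"
    and S: "\<And>i. i \<in> I \<Longrightarrow> w i sums S i"
  shows "((\<lambda>n. \<Prod>i\<in>I. w i (n i)) has_sum (\<Prod>i\<in>I. S i)) (I \<rightarrow>\<^sub>E UNIV)"
proof -
  have ws: "(w i has_sum S i) UNIV" if "i \<in> I" for i
    using w[OF that] S[OF that] by (rule norm_summable_imp_has_sum)
  have "(\<lambda>n. norm (w i n)) summable_on UNIV" if "i \<in> I" for i
    by (rule norm_summable_imp_summable_on) (use w[OF that] in simp)
  from infsum_prod_PiE_abs[OF assms(1) this]
  have "infsum (\<lambda>n. \<Prod>i\<in>I. w i (n i)) (I \<rightarrow>\<^sub>E UNIV) = (\<Prod>i\<in>I. infsum (w i) UNIV)" .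
  also have "\<dots> = (\<Prod>i\<in>I. S i)"
    by (intro prod.cong refl infsumI ws)
  finally have "infsum (\<lambda>n. \<Prod>i\<in>I. w i (n i)) (I \<rightarrow>\<^sub>E UNIV) = (\<Prod>i\<in>I. S i)" .
  moreover have "(\<lambda>n. \<Prod>i\<in>I. w i (n i)) summable_on (I \<rightarrow>\<^sub>E UNIV)"
    by (rule abs_summable_summable, rule prod_PiE_abs_summable_on[OF assms(1) w])
  ultimately show ?thesis
    using has_sum_infsum by metis
qed

lemma abs_summable_on_Times_mult:
  fixes f :: "'a \<Rightarrow> complex" and g :: "'b \<Rightarrow> complex"
  assumes "(\<lambda>s. norm (f s)) summable_on A" "(\<lambda>t. norm (g t)) summable_on B"
  shows "(\<lambda>p. norm (case p of (s, t) \<Rightarrow> f s * g t)) summable_on A \<times> B"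
  unfolding Infinite_Sum.abs_summable_on_Sigma_iff prod.case norm_mult infsum_cmult_right' real_norm_def abs_mult abs_norm_cancel
  by (intro conjI ballI summable_on_cmult_right summable_on_cmult_left assms)

text \<open>
  Fubini for series, with the inner and outer sums over the natural numbers given as ordinary
  (ordered) series: absolute summability over \<open>A \<times> UNIV\<close> makes them unordered sums, and both
  iterated sums equal the sum over the product.
\<close>
lemma has_sum_interchange_sums:
  fixes f :: "'a \<Rightarrow> nat \<Rightarrow> complex"
  assumes f: "(\<lambda>p. norm (case p of (s, m) \<Rightarrow> f s m)) summable_on A \<times> UNIV"
    and r: "\<And>s. s \<in> A \<Longrightarrow> f s sums r s"
    and c: "\<And>m. ((\<lambda>s. f s m) has_sum c m) A"
  obtains S where "(r has_sum S) A" "c sums S"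
proof -
  have row: "(f s has_sum r s) UNIV" if "s \<in> A" for s
  proof -
    have "(\<lambda>m. norm (f s m)) summable_on UNIV"
      using f that unfolding Infinite_Sum.abs_summable_on_Sigma_iff by auto
    then have "summable (\<lambda>m. norm (f s m))"
      by (rule summable_on_imp_summable)
    then show ?thesis
      using r[OF that] by (rule norm_summable_imp_has_sum)
  qed
  obtain S where S: "((\<lambda>(s, m). f s m) has_sum S) (A \<times> UNIV)"
    using abs_summable_summable[OF f] unfolding summable_on_def by blast
  have "(r has_sum S) A"
    by (rule has_sum_SigmaD[OF S]) (use row in simp)
  moreover have "((\<lambda>(m, s). f s m) has_sum S) (UNIV \<times> A)"
    using has_sum_swap[THEN iffD1, OF S] by simp
  then have "(c has_sum S) UNIV"
    by (rule has_sum_SigmaD) (use c in simp)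
  then have "c sums S"
    by (rule has_sum_imp_sums)
  ultimately show thesis by (rule that)
qed

section \<open>The multiple series as a basic hypergeometric series\<close>

theorem theorem1p9:
  fixes q a c :: complex and k :: nat and \<alpha> \<beta> x y :: "nat \<Rightarrow> complex"
  assumes "cmod q < 1" and "k \<ge> 1"
    and "cmod a < 1" and "cmod c < 1"
    and "\<And>j. j \<in> {1..k} \<Longrightarrow> cmod (x j) < 1"
    and "\<And>j. j \<in> {1..k} \<Longrightarrow> cmod (y j) < 1"
    and "a \<noteq> 0"
    and "\<And>j i. j \<in> {1..k} \<Longrightarrow> 1 - \<alpha> j * x j * q ^ i \<noteq> 0"
    and "\<And>j i. j \<in> {1..k} \<Longrightarrow> 1 - \<beta> j * y j * q ^ i \<noteq> 0"
  shows "((\<lambda>n. qpoch a q (\<Sum>j\<in>{1..k}. n j)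
               * (\<Prod>j\<in>{1..k}. qPhi (n j) (\<alpha> j) (\<beta> j) (x j) (y j) q)
               / (qpoch c q (\<Sum>j\<in>{1..k}. n j) * (\<Prod>j\<in>{1..k}. qpoch q q (n j))))
          has_sum
          (qpochs_inf (a # interleave k (\<lambda>j. \<alpha> j * x j) (\<lambda>j. \<beta> j * y j)) q
             / qpochs_inf (c # interleave k x y) q
           * basic_hypergeometric
               (c / a # interleave k x y)
               (interleave k (\<lambda>j. \<alpha> j * x j) (\<lambda>j. \<beta> j * y j)) q a))
         ({1..k} \<rightarrow>\<^sub>E (UNIV :: nat set))"
proof -
  note q = assms(1) and a = assms(3,7) and c = assms(4)
  \<comment> \<open>\<open>C * u m * (q ^ m) ^ N\<close> is the \<open>m\<close>-th term of the expansion of \<open>(a;q)\<^sub>N / (c;q)\<^sub>N\<close>, and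
    \<open>K j * R j m\<close> is the generating function of \<open>w j\<close> at \<open>q ^ m\<close>, split into its value at \<open>1\<close>
    and a quotient of finite products.\<close>
  define w where "w = (\<lambda>j n. qPhi n (\<alpha> j) (\<beta> j) (x j) (y j) q / qpoch q q n)"
  define u where "u = (\<lambda>m. qpoch (c / a) q m / qpoch q q m * a ^ m)"
  define C where "C = qpoch_inf a q / qpoch_inf c q"
  define K where "K = (\<lambda>j. qpoch_inf (\<alpha> j * x j) q * qpoch_inf (\<beta> j * y j) q
    / (qpoch_inf (x j) q * qpoch_inf (y j) q))"
  define R where "R = (\<lambda>j m. qpoch (x j) q m * qpoch (y j) q m
    / (qpoch (\<alpha> j * x j) q m * qpoch (\<beta> j * y j) q m))"
  define F where "F = (\<lambda>n m. (\<Prod>j\<in>{1..k}. w j (n j)) * (C * (u m * (q ^ m) ^ (\<Sum>j\<in>{1..k}. n j))))"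
  define h where "h = (\<lambda>m. u m * (\<Prod>j\<in>{1..k}. R j m))"

  have qm: "cmod (q ^ m) \<le> 1" for m
    using q by (simp add: norm_power power_le_one)
  note small = norm_mult_power_less_one[OF q]

  have w: "summable (\<lambda>n. norm (w j n))" if j: "j \<in> {1..k}" for j
    using qPhi_generating_function_abs_summable[OF q, of "x j" 1 "y j"] assms(5,6)[OF j]
    by (simp add: w_def)
  have u: "summable (\<lambda>m. norm (C * u m))"
    unfolding u_def norm_mult[of C]
    by (rule summable_mult[OF qbinomial_series_abs_summable[OF q a(1)]])

  \<comment> \<open>Dropping the factor \<open>(q ^ m) ^ N\<close>, of modulus at most one, decouples \<open>m\<close> from the \<open>n j\<close>.\<close>
  have F_abs_summable: "(\<lambda>p. norm (case p of (n, m) \<Rightarrow> F n m)) summable_on ({1..k} \<rightarrow>\<^sub>E UNIV) \<times> UNIV"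
  proof (rule Infinite_Sum.abs_summable_on_comparison_test)
    show "(\<lambda>p. norm (case p of (n, m) \<Rightarrow> (\<Prod>j\<in>{1..k}. w j (n j)) * (C * u m))) summable_on ({1..k} \<rightarrow>\<^sub>E UNIV) \<times> UNIV"
      using u by (intro abs_summable_on_Times_mult prod_PiE_abs_summable_on w norm_summable_imp_summable_on) auto
    fix p :: "(nat \<Rightarrow> nat) \<times> nat"
    obtain n m where p: "p = (n, m)" by (cases p)
    define P where "P = (\<Prod>j\<in>{1..k}. w j (n j))"
    have "cmod (P * (C * u m) * (q ^ m) ^ (\<Sum>j\<in>{1..k}. n j)) \<le> cmod (P * (C * u m)) * 1"
      unfolding norm_mult[of "P * _"] norm_power[of "q ^ m"]
      by (intro mult_left_mono power_le_one qm) auto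
    then show "cmod (case p of (n, m) \<Rightarrow> F n m)
      \<le> cmod (case p of (n, m) \<Rightarrow> (\<Prod>j\<in>{1..k}. w j (n j)) * (C * u m))"
      by (simp add: p F_def P_def mult.assoc)
  qed

  have F_row: "F n sums (qpoch a q (\<Sum>j\<in>{1..k}. n j)
               * (\<Prod>j\<in>{1..k}. qPhi (n j) (\<alpha> j) (\<beta> j) (x j) (y j) q)
               / (qpoch c q (\<Sum>j\<in>{1..k}. n j) * (\<Prod>j\<in>{1..k}. qpoch q q (n j))))" for n
  proof -
    have "F n sums ((\<Prod>j\<in>{1..k}. w j (n j)) * (qpoch a q (\<Sum>j\<in>{1..k}. n j) / qpoch c q (\<Sum>j\<in>{1..k}. n j)))"
      unfolding F_def C_def u_def by (intro sums_mult qpoch_ratio_series q a c)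
    then show ?thesis
      by (simp add: w_def prod_dividef mult.commute)
  qed

  have F_column: "((\<lambda>n. F n m) has_sum (C * (\<Prod>j\<in>{1..k}. K j) * h m)) ({1..k} \<rightarrow>\<^sub>E UNIV)" for m
  proof -
    have gen: "(\<lambda>n. w j n * (q ^ m) ^ n) sums (K j * R j m)"
      and gen_abs: "summable (\<lambda>n. norm (w j n * (q ^ m) ^ n))" if j: "j \<in> {1..k}" for j
    proof -
      note xy = assms(5,6)[OF j]
      note small_xy = small[OF xy(1), of m] small[OF xy(2), of m]
      have nz: "qpoch (x j) q m \<noteq> 0" "qpoch (y j) q m \<noteq> 0"
        "qpoch (\<alpha> j * x j) q m \<noteq> 0" "qpoch (\<beta> j * y j) q m \<noteq> 0"
        using qpoch_nonzero[OF q xy(1)] qpoch_nonzero[OF q xy(2)] assms(8,9)[OF j]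
        by (simp_all add: qpoch_def)
      have split: "K j * R j m = qpoch_inf (\<alpha> j * x j * q ^ m) q * qpoch_inf (\<beta> j * y j * q ^ m) q
          / (qpoch_inf (x j * q ^ m) q * qpoch_inf (y j * q ^ m) q)"
        using nz by (simp add: K_def R_def qpoch_inf_split[OF q, of "\<alpha> j * x j" m]
            qpoch_inf_split[OF q, of "\<beta> j * y j" m] qpoch_inf_split[OF q, of "x j" m]
            qpoch_inf_split[OF q, of "y j" m])
      show "(\<lambda>n. w j n * (q ^ m) ^ n) sums (K j * R j m)"
        unfolding split w_def by (rule qPhi_generating_function[OF q small_xy])
      show "summable (\<lambda>n. norm (w j n * (q ^ m) ^ n))"
        unfolding w_def by (rule qPhi_generating_function_abs_summable[OF q small_xy])
    qed
    have "((\<lambda>n. \<Prod>j\<in>{1..k}. w j (n j) * (q ^ m) ^ n j) has_sum (\<Prod>j\<in>{1..k}. K j * R j m)) ({1..k} \<rightarrow>\<^sub>E UNIV)"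
      by (intro prod_PiE_has_sum gen gen_abs) auto
    from has_sum_cmult_right[OF this, of "C * u m"] show ?thesis
      by (simp add: F_def h_def prod.distrib power_sum mult_ac)
  qed

  obtain S where S: "((\<lambda>n. qpoch a q (\<Sum>j\<in>{1..k}. n j)
               * (\<Prod>j\<in>{1..k}. qPhi (n j) (\<alpha> j) (\<beta> j) (x j) (y j) q)
               / (qpoch c q (\<Sum>j\<in>{1..k}. n j) * (\<Prod>j\<in>{1..k}. qpoch q q (n j)))) has_sum S)
        ({1..k} \<rightarrow>\<^sub>E UNIV)" "(\<lambda>m. C * (\<Prod>j\<in>{1..k}. K j) * h m) sums S"
    using has_sum_interchange_sums[OF F_abs_summable F_row F_column] by blast

  \<comment> \<open>A nonzero constant can be cancelled from the convergent series \<open>S(2)\<close>, which yields the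
    convergence of the series of the \<open>h m\<close> as well as its value.\<close>
  have nonzero: "C * (\<Prod>j\<in>{1..k}. K j) \<noteq> 0"
  proof -
    have inf_nz: "qpoch_inf z q \<noteq> 0" if "cmod z < 1" for z
      by (intro qpoch_inf_nonzero one_minus_mult_power_nonzero q that)
    have "K j \<noteq> 0" if j: "j \<in> {1..k}" for j
      using inf_nz[OF assms(5)[OF j]] inf_nz[OF assms(6)[OF j]]
        qpoch_inf_nonzero[OF q assms(8)[OF j]] qpoch_inf_nonzero[OF q assms(9)[OF j]]
      by (simp add: K_def)
    then show ?thesis
      using inf_nz[OF a(1)] inf_nz[OF c] by (simp add: C_def)
  qed
  then have "h sums (S / (C * (\<Prod>j\<in>{1..k}. K j)))"
    using sums_divide[OF S(2), of "C * (\<Prod>j\<in>{1..k}. K j)"] by simp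
  then have "S = C * (\<Prod>j\<in>{1..k}. K j) * suminf h"
    using nonzero by (simp add: sums_iff)
  moreover have "C * (\<Prod>j\<in>{1..k}. K j)
      = qpochs_inf (a # interleave k (\<lambda>j. \<alpha> j * x j) (\<lambda>j. \<beta> j * y j)) q
             / qpochs_inf (c # interleave k x y) q"
    by (simp add: qpochs_inf_def prod_list_map_interleave C_def K_def prod_dividef)
  moreover have "suminf h = basic_hypergeometric
               (c / a # interleave k x y)
               (interleave k (\<lambda>j. \<alpha> j * x j) (\<lambda>j. \<beta> j * y j)) q a"
    by (simp add: basic_hypergeometric_def qpochs_def prod_list_map_interleave length_interleave
        h_def u_def R_def prod_dividef mult_ac)
  ultimately show ?thesis
    using S(1) by simp
qed

end
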